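(* (Tchebichev's inequality) Let $E$ be a $T$-universally complete Riesz space, where $T$ is a strictly positive conditional expectation operator on $E$, with weak order unit $e=Te$. Let $f\in\mathcal{L}^2(T)$, $f\ge 0$, and $\epsilon\in\mathbb{R}$, $\epsilon>0$. Then $$TP_{(f-\epsilon e)^+}e\le\frac{1}{\epsilon^2}T(f^2).$$
   Context: A conditional expectation operator on a Dedekind complete Riesz space $E$ with weak order unit is a positive order continuous projection $T:E\to E$ whose range $\mathcal{R}(T)$ is a Dedekind complete Riesz subspace of $E$ and such that $Te$ is a weak order unit of $E$ for each weak order unit $e$ of $E$. $T$ is strictly positive if $f\ge 0$ and $Tf=0$ imply $f=0$. Given a strictly positive conditional expectation operator $T$ on a Dedekind complete Riesz space $E$ with weak order unit, $E$ is called $T$-universally complete if each increasing net $(f_\alpha)$ in $E_+$ for which $(Tf_\alpha)$ is order bounded in the universal completion $E^u$ of $E$ is order convergent in $E$. (A $T$-universally complete space is in particular Dedekind complete.) The universal completion $E^u$ carries its natural $f$-algebra multiplication with multiplicative unit $e$, determined by $(Pe)\cdot(Qe)=PQe$ for band projections $P,Q$. All products and powers are taken in $E^u$. For $E$ $T$-universally complete, $\mathcal{L}^1(T)=E$ and $\mathcal{L}^2(T):=\{x\in\mathcal{L}^1(T) : x^2\in\mathcal{L}^1(T)\}$. For $h\in E_+$, $P_h$ denotes the band projection of $E$ onto the band generated by $h$. *)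

theory Defs
  imports Complex_Main  "HOL-Library.Lub_Glb" "HOL-Library.Lattice_Algebras"
begin

section \<open>Riesz spaces\<close>

class riesz_space = ordered_real_vector + lattice_ab_group_add_abs

text \<open>Suprema are taken relative to a set, so that the notion also applies to a Riesz subspace
  with its own order, such as the range of an operator.\<close>

definition dedekind_complete :: "'a::riesz_space set \<Rightarrow> bool" where
  "dedekind_complete A \<longleftrightarrow>
     (\<forall>S\<subseteq>A. S \<noteq> {} \<longrightarrow> (\<exists>b. isUb A S b) \<longrightarrow> (\<exists>s. isLub A S s))"

definition laterally_complete :: "'a::riesz_space set \<Rightarrow> bool" where
  "laterally_complete A \<longleftrightarrow>
     (\<forall>S\<subseteq>A. S \<noteq> {} \<longrightarrow> (\<forall>x\<in>S. 0 \<le> x) \<longrightarrow> pairwise (\<lambda>x y. inf x y = 0) S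
        \<longrightarrow> (\<exists>s. isLub A S s))"

definition riesz_subspace :: "'a::riesz_space set \<Rightarrow> bool" where
  "riesz_subspace A \<longleftrightarrow> subspace A \<and> (\<forall>x\<in>A. \<forall>y\<in>A. sup x y \<in> A \<and> inf x y \<in> A)"

definition order_ideal :: "'a::riesz_space set \<Rightarrow> bool" where
  "order_ideal A \<longleftrightarrow> subspace A \<and> (\<forall>x\<in>A. \<forall>y. \<bar>y\<bar> \<le> \<bar>x\<bar> \<longrightarrow> y \<in> A)"

definition is_band :: "'a::riesz_space set \<Rightarrow> bool" where
  "is_band B \<longleftrightarrow> order_ideal B \<and> (\<forall>S s. S \<subseteq> B \<longrightarrow> isLub UNIV S s \<longrightarrow> s \<in> B)"

definition generated_band :: "'a::riesz_space \<Rightarrow> 'a set" where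
  "generated_band h = is_band hull {h}"

definition disjoint_complement :: "'a::riesz_space set \<Rightarrow> 'a set" where
  "disjoint_complement B = {x. \<forall>y\<in>B. inf \<bar>x\<bar> \<bar>y\<bar> = 0}"

text \<open>The projection along the decomposition of the space into \<open>B\<close> and its disjoint complement.
  In a Dedekind complete space every band \<open>B\<close> has this decomposition.\<close>

definition band_projection :: "'a::riesz_space set \<Rightarrow> 'a \<Rightarrow> 'a" where
  "band_projection B x = (THE y. y \<in> B \<and> x - y \<in> disjoint_complement B)"

definition weak_order_unit :: "'a::riesz_space \<Rightarrow> bool" where
  "weak_order_unit e \<longleftrightarrow> 0 \<le> e \<and> generated_band e = UNIV"


section \<open>Order convergence\<close>

text \<open>A net is given by a function together with the filter of tails of its index set. The set
  \<open>D\<close> is the range of a net decreasing to \<open>0\<close> that dominates the distances to the limit.\<close>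

definition order_converges :: "('i \<Rightarrow> 'a::riesz_space) \<Rightarrow> 'a \<Rightarrow> 'i filter \<Rightarrow> bool" where
  "order_converges f l F \<longleftrightarrow>
     (\<exists>D. D \<noteq> {} \<and> (\<forall>x\<in>D. \<forall>y\<in>D. \<exists>z\<in>D. z \<le> x \<and> z \<le> y) \<and> isGlb UNIV D 0 \<and>
          (\<forall>d\<in>D. eventually (\<lambda>i. \<bar>f i - l\<bar> \<le> d) F))"

text \<open>Convergence of a net in the space depends only on the image of its filter of tails, so it is
  enough to let the identity run along all filters on the space.\<close>

definition order_continuous :: "('a::riesz_space \<Rightarrow> 'b::riesz_space) \<Rightarrow> bool" where
  "order_continuous T \<longleftrightarrow>
     (\<forall>F x. order_converges (\<lambda>y. y) x F \<longrightarrow> order_converges T (T x) F)"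

definition upward_directed :: "'a::order set \<Rightarrow> bool" where
  "upward_directed D \<longleftrightarrow> D \<noteq> {} \<and> (\<forall>x\<in>D. \<forall>y\<in>D. \<exists>z\<in>D. x \<le> z \<and> y \<le> z)"

definition tails :: "'a::order set \<Rightarrow> 'a filter" where
  "tails D = (INF d\<in>D. principal {x \<in> D. d \<le> x})"


section \<open>Universal completion and its multiplication\<close>

text \<open>The universal completion is unique only up to isomorphism, so it appears as an arbitrary
  universally complete space together with an embedding \<open>\<iota>\<close> of the given space as an order dense
  Riesz subspace.\<close>

definition universal_completion :: "('a::riesz_space \<Rightarrow> 'u::riesz_space) \<Rightarrow> bool" where
  "universal_completion \<iota> \<longleftrightarrow>
     dedekind_complete (UNIV :: 'u set) \<and> laterally_complete (UNIV :: 'u set) \<and>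
     linear \<iota> \<and> inj \<iota> \<and>
     (\<forall>x y. \<iota> (sup x y) = sup (\<iota> x) (\<iota> y) \<and> \<iota> (inf x y) = inf (\<iota> x) (\<iota> y)) \<and>
     (\<forall>u>0. \<exists>x. 0 < \<iota> x \<and> \<iota> x \<le> u)"

definition f_algebra_mult :: "('u::riesz_space \<Rightarrow> 'u \<Rightarrow> 'u) \<Rightarrow> bool" where
  "f_algebra_mult m \<longleftrightarrow>
     (\<forall>x. linear (m x)) \<and> (\<forall>y. linear (\<lambda>x. m x y)) \<and>
     (\<forall>x y z. m (m x y) z = m x (m y z)) \<and>
     (\<forall>x\<ge>0. \<forall>y\<ge>0. 0 \<le> m x y) \<and>
     (\<forall>x y. \<forall>z\<ge>0. inf x y = 0 \<longrightarrow> inf (m x z) y = 0 \<and> inf (m z x) y = 0)"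

text \<open>For a weak order unit \<open>u\<close> of a universally complete space there is exactly one such
  multiplication.\<close>

definition natural_mult :: "'u::riesz_space \<Rightarrow> ('u \<Rightarrow> 'u \<Rightarrow> 'u) \<Rightarrow> bool" where
  "natural_mult u m \<longleftrightarrow>
     f_algebra_mult m \<and> (\<forall>x. m u x = x \<and> m x u = x) \<and>
     (\<forall>B C. is_band B \<longrightarrow> is_band C \<longrightarrow>
        m (band_projection B u) (band_projection C u) = band_projection B (band_projection C u))"


section \<open>Conditional expectation operators\<close>

definition conditional_expectation :: "('a::riesz_space \<Rightarrow> 'a) \<Rightarrow> bool" where
  "conditional_expectation T \<longleftrightarrow>
     dedekind_complete (UNIV :: 'a set) \<and> (\<exists>e::'a. weak_order_unit e) \<and>
     linear T \<and> (\<forall>x\<ge>0. 0 \<le> T x) \<and> order_continuous T \<and> T \<circ> T = T \<and>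
     riesz_subspace (range T) \<and> dedekind_complete (range T) \<and>
     (\<forall>e. weak_order_unit e \<longrightarrow> weak_order_unit (T e))"

definition strictly_positive :: "('a::riesz_space \<Rightarrow> 'a) \<Rightarrow> bool" where
  "strictly_positive T \<longleftrightarrow> (\<forall>f. 0 \<le> f \<longrightarrow> T f = 0 \<longrightarrow> f = 0)"

text \<open>An increasing net is represented by its range \<open>D\<close>, an upward directed set indexed by itself.
  This loses nothing: order convergence of an increasing net depends only on its range.\<close>

definition T_universally_complete ::
    "('a::riesz_space \<Rightarrow> 'u::riesz_space) \<Rightarrow> ('a \<Rightarrow> 'a) \<Rightarrow> bool" where
  "T_universally_complete \<iota> T \<longleftrightarrow>
     (\<forall>D. upward_directed D \<longrightarrow> (\<forall>x\<in>D. 0 \<le> x) \<longrightarrow> (\<exists>a b. \<forall>x\<in>D. a \<le> \<iota> (T x) \<and> \<iota> (T x) \<le> b)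
        \<longrightarrow> (\<exists>l. order_converges (\<lambda>x. x) l (tails D)))"

text \<open>Since \<open>L\<^sup>1(T)\<close> is the whole space, membership of a square in \<open>L\<^sup>1(T)\<close> means that the product,
  which is formed in the universal completion, lies in the embedded copy of the space.\<close>

definition L2 :: "('a::riesz_space \<Rightarrow> 'u::riesz_space) \<Rightarrow> ('u \<Rightarrow> 'u \<Rightarrow> 'u) \<Rightarrow> 'a set" where
  "L2 \<iota> m = {x. m (\<iota> x) (\<iota> x) \<in> range \<iota>}"

definition square :: "('a::riesz_space \<Rightarrow> 'u::riesz_space) \<Rightarrow> ('u \<Rightarrow> 'u \<Rightarrow> 'u) \<Rightarrow> 'a \<Rightarrow> 'a" where
  "square \<iota> m x = the_inv \<iota> (m (\<iota> x) (\<iota> x))"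

end

theory Submission
  imports Defs
begin

text \<open>
  As for real random variables, the inequality is the image under \<open>T\<close> of a pointwise one:
  \<open>\<epsilon>\<^sup>2 1\<^bsub>{f > \<epsilon>}\<^esub> \<le> f\<^sup>2\<close>. Write \<open>h = (f - \<epsilon> e)\<^sup>+\<close>. The component \<open>P\<^sub>h e\<close>, which stands for the
  indicator function, is the supremum of the elements \<open>e \<and> n h\<close>
  (\<open>band_projection_generated_band\<close>), so it is enough to show \<open>\<epsilon>\<^sup>2 (e \<and> n h) \<le> f\<^sup>2\<close> for each \<open>n\<close>,
  an inequality between two elements that can be checked inside the universal completion.

  Let \<open>a = e \<and> n h\<close>. Since \<open>a\<close> lives where \<open>f - \<epsilon> e\<close> is positive, it is disjoint from the negative
  part of \<open>f - \<epsilon> e\<close>. Disjoint elements of an \<open>f\<close>-algebra have product \<open>0\<close>, hence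
  \<open>a (f - \<epsilon> e) \<ge> 0\<close>, that is, \<open>\<epsilon> a \<le> a f\<close>. Multiplying by \<open>f\<close> and using this bound twice gives
  \<open>\<epsilon>\<^sup>2 a \<le> a f\<^sup>2\<close>, and \<open>a f\<^sup>2 \<le> f\<^sup>2\<close> because \<open>a \<le> e\<close> (\<open>f_algebra_truncation_le_square\<close>).
\<close>

section \<open>Disjointness and bands\<close>

lemma inf_add_le:
  fixes a b c :: "'a::riesz_space"
  assumes "0 \<le> a" "0 \<le> b" "0 \<le> c"
  shows "inf (a + b) c \<le> inf a c + inf b c"
proof -
  have "inf (a + b) c \<le> d" if "c \<le> d" for d
    using that by (rule le_infI2)
  moreover have "c \<le> a + c" "c \<le> c + b" "c \<le> c + c"
    using assms by simp_all
  ultimately show ?thesis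
    by (simp add: add_inf_distrib_left add_inf_distrib_right)
qed

lemma inf_add_eq_0:
  fixes a b c :: "'a::riesz_space"
  assumes "0 \<le> a" "0 \<le> b" "0 \<le> c" "inf a c = 0" "inf b c = 0"
  shows "inf (a + b) c = 0"
proof (rule antisym)
  show "inf (a + b) c \<le> 0" using inf_add_le[of a b c] assms by simp
  show "0 \<le> inf (a + b) c" using assms by simp
qed

lemma inf_eq_0_mono:
  fixes a b c :: "'a::riesz_space"
  assumes "0 \<le> b" "b \<le> a" "0 \<le> c" "inf a c = 0"
  shows "inf b c = 0"
proof (rule antisym)
  show "inf b c \<le> 0" using inf_mono[OF \<open>b \<le> a\<close> order_refl[of c]] assms by simp
  show "0 \<le> inf b c" using assms by simp
qed

lemma inf_pprt_nprt: "inf (pprt x) (- nprt x) = 0"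
  for x :: "'a::riesz_space"
proof -
  \<comment> \<open>translating both arguments by \<open>nprt x\<close> turns them into \<open>x\<close> and \<open>0\<close>\<close>
  have "inf (pprt x) (- nprt x) + nprt x = inf (pprt x + nprt x) (- nprt x + nprt x)"
    by (simp only: add_inf_distrib_right)
  also have "\<dots> = nprt x" by (simp flip: prts) (simp add: nprt_def)
  finally show ?thesis by simp
qed

lemma inf_scaleR_nat_eq_0:
  fixes a c :: "'a::riesz_space"
  assumes "0 \<le> a" "0 \<le> c" "inf a c = 0"
  shows "inf (real n *\<^sub>R a) c = 0"
proof (induction n)
  case 0
  then show ?case using assms by (simp add: inf_absorb1)
next
  case (Suc n)
  then show ?case
    using inf_add_eq_0[of a "real n *\<^sub>R a" c] assms
    by (simp add: scaleR_add_left scaleR_nonneg_nonneg)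
qed

lemma abs_scaleR_le_nat:
  fixes x :: "'a::riesz_space"
  assumes "\<bar>c\<bar> \<le> real n"
  shows "\<bar>c *\<^sub>R x\<bar> \<le> real n *\<^sub>R \<bar>x\<bar>"
proof -
  have bound: "d *\<^sub>R x \<le> real n *\<^sub>R \<bar>x\<bar>" if "\<bar>d\<bar> = \<bar>c\<bar>" for d
  proof -
    have "d *\<^sub>R x \<le> \<bar>d\<bar> *\<^sub>R \<bar>x\<bar>"
    proof (cases "0 \<le> d")
      case True
      then show ?thesis by (simp add: scaleR_left_mono abs_ge_self)
    next
      case False
      then have "(- d) *\<^sub>R (- x) \<le> (- d) *\<^sub>R \<bar>x\<bar>"
        by (intro scaleR_left_mono) (simp_all add: abs_ge_minus_self)
      then show ?thesis using False by simp
    qed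
    also have "\<dots> \<le> real n *\<^sub>R \<bar>x\<bar>"
      using that assms by (intro scaleR_right_mono) simp_all
    finally show ?thesis .
  qed
  show ?thesis
    using bound[of c] bound[of "- c"] by (intro abs_leI) simp_all
qed

lemma order_ideal_disjoint_complement: "order_ideal (disjoint_complement A)"
  for A :: "'a::riesz_space set"
  unfolding order_ideal_def subspace_def
proof (intro conjI ballI allI impI)
  show "0 \<in> disjoint_complement A"
    by (simp add: disjoint_complement_def inf_absorb1)
next
  fix x y
  assume "x \<in> disjoint_complement A" "\<bar>y\<bar> \<le> \<bar>x\<bar>"
  then show "y \<in> disjoint_complement A"
    unfolding disjoint_complement_def
    using inf_eq_0_mono[of "\<bar>y\<bar>" "\<bar>x\<bar>"] by simp
next
  fix x y
  assume "x \<in> disjoint_complement A" "y \<in> disjoint_complement A"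
  then have "inf (\<bar>x\<bar> + \<bar>y\<bar>) \<bar>z\<bar> = 0" if "z \<in> A" for z
    using that by (intro inf_add_eq_0) (simp_all add: disjoint_complement_def)
  then show "x + y \<in> disjoint_complement A"
    unfolding disjoint_complement_def
    using inf_eq_0_mono[of "\<bar>x + y\<bar>" "\<bar>x\<bar> + \<bar>y\<bar>"] by (simp add: abs_triangle_ineq)
next
  fix c :: real and x
  assume x: "x \<in> disjoint_complement A"
  obtain n :: nat where n: "\<bar>c\<bar> \<le> real n"
    using real_arch_simple by blast
  have "inf \<bar>c *\<^sub>R x\<bar> \<bar>z\<bar> = 0" if "z \<in> A" for z
    using inf_eq_0_mono[of "\<bar>c *\<^sub>R x\<bar>" "real n *\<^sub>R \<bar>x\<bar>" "\<bar>z\<bar>"] abs_scaleR_le_nat[OF n, of x]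
      inf_scaleR_nat_eq_0[of "\<bar>x\<bar>" "\<bar>z\<bar>" n] x that
    by (simp add: disjoint_complement_def)
  then show "c *\<^sub>R x \<in> disjoint_complement A"
    by (simp add: disjoint_complement_def)
qed

text \<open>Let \<open>s\<close> be the supremum of elements \<open>x\<close> disjoint from \<open>z\<close>, and let \<open>w = s\<^sup>+ \<and> |z|\<close>. Since
  \<open>s\<^sup>+ \<le> (s - x) + x\<^sup>+\<close> and \<open>x\<^sup>+\<close> is disjoint from \<open>w\<close>, all of \<open>w\<close> lies below \<open>s - x\<close>. So \<open>s - w\<close> is
  still an upper bound, which forces \<open>w = 0\<close>. The negative part of \<open>s\<close> is dominated by that of any
  single \<open>x\<close>.\<close>

lemma is_band_disjoint_complement: "is_band (disjoint_complement A)"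
  for A :: "'a::riesz_space set"
  unfolding is_band_def
proof (intro conjI allI impI)
  show ideal: "order_ideal (disjoint_complement A)"
    by (rule order_ideal_disjoint_complement)
  fix S s
  assume S: "S \<subseteq> disjoint_complement A" and s: "isLub UNIV S s"
  have le_s: "x \<le> s" if "x \<in> S" for x
    using s that by (simp add: isLub_def isUb_def leastP_def setle_def)
  have s_le: "s \<le> b" if "\<And>x. x \<in> S \<Longrightarrow> x \<le> b" for b
    using s that by (simp add: isLub_def isUb_def leastP_def setle_def setge_def)
  show "s \<in> disjoint_complement A"
  proof (cases "S = {}")
    case True
    \<comment> \<open>a supremum of the empty set is a least element, which only the zero space has\<close>
    then have least: "s \<le> b" for b by (intro s_le) simp
    have "s \<le> 0" "s \<le> s + s" by (rule least)+
    then have "s = 0" by (intro antisym) simp_all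
    then show ?thesis using ideal by (simp add: order_ideal_def subspace_def)
  next
    case False
    then obtain x0 where x0: "x0 \<in> S" by blast
    have "inf \<bar>s\<bar> \<bar>z\<bar> = 0" if z: "z \<in> A" for z
    proof -
      have disj: "inf \<bar>x\<bar> \<bar>z\<bar> = 0" if "x \<in> S" for x
        using S z that by (auto simp: disjoint_complement_def)
      define w where "w = inf (pprt s) \<bar>z\<bar>"
      have w: "0 \<le> w" "w \<le> pprt s" "w \<le> \<bar>z\<bar>" by (simp_all add: w_def)
      have "s \<le> s - w"
      proof (rule s_le)
        fix x assume x: "x \<in> S"
        have "pprt x \<le> \<bar>x\<bar>" by (simp add: pprt_def abs_ge_self)
        then have "inf (pprt x) \<bar>z\<bar> = 0"
          using inf_eq_0_mono[of "pprt x" "\<bar>x\<bar>"] disj[OF x] by simp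
        then have px: "inf (pprt x) w = 0"
          using inf_eq_0_mono[of w "\<bar>z\<bar>" "pprt x"] w by (simp add: inf_commute)
        have "pprt s \<le> (s - x) + pprt x"
          using le_s[OF x] by (simp add: pprt_def add_sup_distrib_left le_supI2)
        with w(2) have "w \<le> (s - x) + pprt x" by (rule order_trans)
        then have "w \<le> inf ((s - x) + pprt x) w" by simp
        also have "\<dots> \<le> inf (s - x) w + inf (pprt x) w"
          using le_s[OF x] w by (intro inf_add_le) simp_all
        finally have "w \<le> s - x" using px by simp
        then show "x \<le> s - w" by (simp add: algebra_simps)
      qed
      then have "w \<le> 0" by simp
      with w(1) have "inf (pprt s) \<bar>z\<bar> = 0" unfolding w_def by (intro antisym)
      moreover have "inf (- nprt s) \<bar>z\<bar> = 0"
      proof (rule inf_eq_0_mono[of _ "\<bar>x0\<bar>"])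
        have "- nprt s \<le> - nprt x0" using nprt_mono[OF le_s[OF x0]] by simp
        also have "\<dots> \<le> \<bar>x0\<bar>" by (simp add: abs_prts)
        finally show "- nprt s \<le> \<bar>x0\<bar>" .
      qed (simp_all add: disj x0)
      ultimately show ?thesis
        using inf_add_eq_0[of "pprt s" "- nprt s" "\<bar>z\<bar>"] by (simp add: abs_prts[of s])
    qed
    then show ?thesis by (simp add: disjoint_complement_def)
  qed
qed

lemma is_band_Inter:
  fixes \<B> :: "'a::riesz_space set set"
  assumes "\<And>B. B \<in> \<B> \<Longrightarrow> is_band B"
  shows "is_band (\<Inter>\<B>)"
proof -
  have "subspace (\<Inter>\<B>)"
    using assms by (auto simp: is_band_def order_ideal_def intro!: subspace_Inter)
  then show ?thesis
    using assms unfolding is_band_def order_ideal_def by blast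
qed

lemma is_band_generated_band: "is_band (generated_band h)"
  unfolding generated_band_def by (rule hull_in) (simp add: is_band_Inter)

section \<open>Projection onto a principal band\<close>

text \<open>In the decomposition \<open>x = y + (x - y)\<close> only \<open>(x - y) \<bottom> h\<close> needs an argument: the common part
  of \<open>x - y\<close> and \<open>h\<close> can be added to \<open>x \<and> n h\<close> without leaving \<open>x \<and> (n + 1) h\<close>, hence to the
  supremum \<open>y\<close>, so it is \<open>0\<close>. Disjointness passes from \<open>h\<close> to its band because disjoint complements
  are bands.\<close>

lemma band_projection_generated_band:
  fixes x h y :: "'a::riesz_space"
  assumes "0 \<le> x" "0 \<le> h" and y: "isLub UNIV (range (\<lambda>n. inf x (real n *\<^sub>R h))) y"
  shows "band_projection (generated_band h) x = y"
proof -
  let ?B = "generated_band h"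
  have ge: "inf x (real n *\<^sub>R h) \<le> y" for n
    using y by (auto simp: isLub_def isUb_def leastP_def setle_def)
  have least: "y \<le> b" if "\<And>n. inf x (real n *\<^sub>R h) \<le> b" for b
    using y that by (auto simp: isLub_def isUb_def leastP_def setle_def setge_def)
  have yx: "y \<le> x" by (rule least) simp
  have ideal: "order_ideal ?B" "order_ideal (disjoint_complement ?B)"
    using is_band_generated_band order_ideal_disjoint_complement by (auto simp: is_band_def)
  have h: "h \<in> ?B" by (simp add: generated_band_def hull_inc)
  have yB: "y \<in> ?B"
  proof -
    have "inf x (real n *\<^sub>R h) \<in> ?B" for n
    proof -
      have "real n *\<^sub>R h \<in> ?B" using h ideal by (simp add: order_ideal_def subspace_def)
      moreover have "\<bar>inf x (real n *\<^sub>R h)\<bar> \<le> \<bar>real n *\<^sub>R h\<bar>"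
        using assms by (simp add: scaleR_nonneg_nonneg abs_of_nonneg)
      ultimately show ?thesis using ideal unfolding order_ideal_def by blast
    qed
    then have "range (\<lambda>n. inf x (real n *\<^sub>R h)) \<subseteq> ?B" by auto
    moreover have "s \<in> ?B" if "S \<subseteq> ?B" "isLub UNIV S s" for S s
      using is_band_generated_band[of h] that by (simp add: is_band_def)
    ultimately show ?thesis using y by simp
  qed
  have disj_h: "inf (x - y) h = 0"
  proof (rule antisym)
    define w where "w = inf (x - y) h"
    have "y \<le> y - w"
    proof (rule least)
      fix n
      have "w + inf x (real n *\<^sub>R h) \<le> (x - y) + y"
        by (rule add_mono[OF _ ge]) (simp add: w_def)
      moreover have "w + inf x (real n *\<^sub>R h) \<le> h + real n *\<^sub>R h"
        by (rule add_mono) (simp_all add: w_def)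
      ultimately have "w + inf x (real n *\<^sub>R h) \<le> inf x (real (Suc n) *\<^sub>R h)"
        by (simp add: scaleR_add_left)
      also have "\<dots> \<le> y" by (rule ge)
      finally show "inf x (real n *\<^sub>R h) \<le> y - w" by (simp add: algebra_simps)
    qed
    then have "w \<le> 0" by simp
    then show "inf (x - y) h \<le> 0" unfolding w_def .
    show "0 \<le> inf (x - y) h" using yx assms by simp
  qed
  have "?B \<subseteq> disjoint_complement {x - y}"
    unfolding generated_band_def
  proof (rule hull_minimal)
    show "{h} \<subseteq> disjoint_complement {x - y}"
      using disj_h yx assms by (simp add: disjoint_complement_def abs_of_nonneg inf_commute)
  qed (rule is_band_disjoint_complement)
  then have disj: "x - y \<in> disjoint_complement ?B"
    by (auto simp: disjoint_complement_def inf_commute)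
  show ?thesis
    unfolding band_projection_def
  proof (rule the_equality)
    show "y \<in> ?B \<and> x - y \<in> disjoint_complement ?B" using yB disj by blast
    fix y'
    assume y': "y' \<in> ?B \<and> x - y' \<in> disjoint_complement ?B"
    have diff: "a - b \<in> C" if "order_ideal C" "a \<in> C" "b \<in> C" for a b and C :: "'a set"
      using that by (simp add: order_ideal_def subspace_diff)
    have "y' - y \<in> ?B" using diff[OF ideal(1)] y' yB by blast
    moreover have "y' - y \<in> disjoint_complement ?B"
      using diff[OF ideal(2) disj conjunct2[OF y']] by simp
    ultimately have "inf \<bar>y' - y\<bar> \<bar>y' - y\<bar> = 0"
      unfolding disjoint_complement_def by blast
    then show "y' = y" by simp
  qed
qed

section \<open>The inequality in the universal completion\<close>

text \<open>Multiplying by a positive element preserves disjointness; doing this once to each of two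
  disjoint positive elements makes their product disjoint from itself.\<close>

lemma f_algebra_mult_disjoint:
  fixes m :: "'u::riesz_space \<Rightarrow> 'u \<Rightarrow> 'u"
  assumes m: "f_algebra_mult m" and "0 \<le> a" "0 \<le> b" "inf a b = 0"
  shows "m a b = 0"
proof -
  have "inf (m a b) b = 0"
    using m assms(3,4) unfolding f_algebra_mult_def by blast
  then have "inf b (m a b) = 0" by (simp add: inf_commute)
  then have "inf (m a b) (m a b) = 0"
    using m assms(2) unfolding f_algebra_mult_def by blast
  then show ?thesis by simp
qed

lemma f_algebra_truncation_le_square:
  fixes m :: "'u::riesz_space \<Rightarrow> 'u \<Rightarrow> 'u"
  assumes m: "f_algebra_mult m" and unit: "\<And>x. m u x = x" "\<And>x. m x u = x"
    and "0 \<le> u" "0 \<le> x" "0 \<le> \<epsilon>"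
  shows "\<epsilon>\<^sup>2 *\<^sub>R inf u (real n *\<^sub>R pprt (x - \<epsilon> *\<^sub>R u)) \<le> m x x"
proof -
  define g where "g = x - \<epsilon> *\<^sub>R u"
  define a where "a = inf u (real n *\<^sub>R pprt g)"
  have lin: "linear (m c)" "linear (\<lambda>b. m b c)" for c
    using m by (auto simp: f_algebra_mult_def)
  have pos: "0 \<le> m b c" if "0 \<le> b" "0 \<le> c" for b c
    using m that by (simp add: f_algebra_mult_def)
  have mono: "m b d \<le> m c d" if "b \<le> c" "0 \<le> d" for b c d
    using pos[of "c - b" d] linear_diff[OF lin(2)[of d], of c b] that by simp
  have assoc: "m (m b c) d = m b (m c d)" for b c d
    using m by (simp add: f_algebra_mult_def)
  have a: "0 \<le> a" "a \<le> u" "a \<le> real n *\<^sub>R pprt g"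
    using assms by (simp_all add: a_def scaleR_nonneg_nonneg)
  have "inf (pprt g) (- nprt g) = 0" by (rule inf_pprt_nprt)
  then have "inf a (- nprt g) = 0"
    using inf_eq_0_mono[of a "real n *\<^sub>R pprt g" "- nprt g"]
      inf_scaleR_nat_eq_0[of "pprt g" "- nprt g" n] a by simp
  then have "m a (- nprt g) = 0"
    using a by (intro f_algebra_mult_disjoint[OF m]) simp_all
  moreover have "m a g = m a (pprt g) - m a (- nprt g)"
    using linear_diff[OF lin(1)[of a], of "pprt g" "- nprt g"] by (simp flip: prts)
  ultimately have "m a g = m a (pprt g)" by simp
  then have "0 \<le> m a g" using pos a by simp
  then have ax: "\<epsilon> *\<^sub>R a \<le> m a x"
    using lin(1)[of a] by (simp add: g_def linear_diff linear_scale unit)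
  have "\<epsilon>\<^sup>2 *\<^sub>R a = \<epsilon> *\<^sub>R (\<epsilon> *\<^sub>R a)" by (simp add: power2_eq_square)
  also have "\<dots> \<le> \<epsilon> *\<^sub>R m a x"
    using ax assms by (intro scaleR_left_mono) simp_all
  also have "\<dots> = m (\<epsilon> *\<^sub>R a) x"
    using linear_scale[OF lin(2)[of x], of \<epsilon> a] by simp
  also have "\<dots> \<le> m (m a x) x"
    using ax assms by (intro mono)
  also have "\<dots> = m a (m x x)" by (rule assoc)
  also have "\<dots> \<le> m u (m x x)"
    using a pos assms by (intro mono)
  finally show ?thesis by (simp add: unit a_def g_def)
qed

section \<open>Tchebichev's inequality\<close>

theorem theorem3p4:
  fixes T :: "'a::riesz_space \<Rightarrow> 'a"
    and \<iota> :: "'a \<Rightarrow> 'u::riesz_space"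
    and m :: "'u \<Rightarrow> 'u \<Rightarrow> 'u"
    and e f :: 'a
    and \<epsilon> :: real
  assumes "conditional_expectation T"
    and "strictly_positive T"
    and "universal_completion \<iota>"
    and "T_universally_complete \<iota> T"
    and "weak_order_unit e"
    and "e = T e"
    and "natural_mult (\<iota> e) m"
    and "f \<in> L2 \<iota> m"
    and "0 \<le> f"
    and "0 < \<epsilon>"
  shows "T (band_projection (generated_band (pprt (f - \<epsilon> *\<^sub>R e))) e)
           \<le> (1 / \<epsilon>\<^sup>2) *\<^sub>R T (square \<iota> m f)"
proof -
  define h where "h = pprt (f - \<epsilon> *\<^sub>R e)"
  let ?S = "range (\<lambda>n. inf e (real n *\<^sub>R h))"
  have e: "0 \<le> e" using assms by (simp add: weak_order_unit_def)
  have T: "linear T" "\<And>x. 0 \<le> x \<Longrightarrow> 0 \<le> T x" "dedekind_complete (UNIV :: 'a set)"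
    using assms by (auto simp: conditional_expectation_def)
  have \<iota>: "linear \<iota>" "inj \<iota>" "\<And>x y. \<iota> (sup x y) = sup (\<iota> x) (\<iota> y)"
      "\<And>x y. \<iota> (inf x y) = inf (\<iota> x) (\<iota> y)"
    using assms by (auto simp: universal_completion_def)
  have \<iota>_le: "\<iota> x \<le> \<iota> y \<longleftrightarrow> x \<le> y" for x y
    using \<iota>(2,3) by (metis le_iff_sup inj_eq)
  have square: "\<iota> (square \<iota> m f) = m (\<iota> f) (\<iota> f)"
    using assms \<iota>(2) by (simp add: square_def L2_def f_the_inv_into_f)
  have \<iota>_pos: "0 \<le> \<iota> x" if "0 \<le> x" for x
    using \<iota>_le[of 0 x] \<iota>(1) that by (simp add: linear_0)

  obtain p where p: "isLub UNIV ?S p"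
  proof -
    have "isUb UNIV ?S e" by (auto simp: isUb_def setle_def)
    then show ?thesis
      using T(3) that unfolding dedekind_complete_def
      by (metis empty_not_UNIV image_is_empty subset_UNIV)
  qed
  have "p \<le> (1 / \<epsilon>\<^sup>2) *\<^sub>R square \<iota> m f"
  proof -
    have "inf e (real n *\<^sub>R h) \<le> (1 / \<epsilon>\<^sup>2) *\<^sub>R square \<iota> m f" for n
    proof -
      have "\<iota> (\<epsilon>\<^sup>2 *\<^sub>R inf e (real n *\<^sub>R h))
          = \<epsilon>\<^sup>2 *\<^sub>R inf (\<iota> e) (real n *\<^sub>R pprt (\<iota> f - \<epsilon> *\<^sub>R \<iota> e))"
        using \<iota> by (simp add: h_def pprt_def linear_scale linear_diff linear_0)
      also have "\<dots> \<le> \<iota> (square \<iota> m f)"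
        unfolding square
        using assms(7) \<iota>_pos e \<open>0 \<le> f\<close> \<open>0 < \<epsilon>\<close>
        by (intro f_algebra_truncation_le_square) (simp_all add: natural_mult_def)
      finally have "\<epsilon>\<^sup>2 *\<^sub>R inf e (real n *\<^sub>R h) \<le> square \<iota> m f" by (simp only: \<iota>_le)
      then have "(1 / \<epsilon>\<^sup>2) *\<^sub>R (\<epsilon>\<^sup>2 *\<^sub>R inf e (real n *\<^sub>R h)) \<le> (1 / \<epsilon>\<^sup>2) *\<^sub>R square \<iota> m f"
        by (intro scaleR_left_mono) simp_all
      then show ?thesis using \<open>0 < \<epsilon>\<close> by simp
    qed
    then show ?thesis
      using p by (auto simp: isLub_def isUb_def leastP_def setle_def setge_def)
  qed
  then have "T p \<le> (1 / \<epsilon>\<^sup>2) *\<^sub>R T (square \<iota> m f)"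
    using T(2)[of "(1 / \<epsilon>\<^sup>2) *\<^sub>R square \<iota> m f - p"] T(1)
    by (simp add: linear_diff linear_scale)
  moreover have "band_projection (generated_band h) e = p"
    using e p by (intro band_projection_generated_band) (simp_all add: h_def)
  ultimately show ?thesis by (simp add: h_def)
qed

end
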